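(* Let $n=p^{3}q$ with primes $2\leq p<q$. Let $\mathcal{D}_{S_{1}},\mathcal{D}_{S_{2}}$ be subsets of $\mathcal{D}_{[n]}\setminus\{n\}$. If $\mathrm{Spec}(\mathrm{ICG}(n,\mathcal{D}_{S_{1}}))=\mathrm{Spec}(\mathrm{ICG}(n,\mathcal{D}_{S_{2}}))$, then $\mathcal{D}_{S_{1}}=\mathcal{D}_{S_{2}}$.
   Context: For an integer $n\ge1$, identify $\mathbb{Z}_n$ with $[n]=\{1,\dots,n\}$ ($n$ playing the role of $0$). For a positive divisor $d$ of $n$, $G_n(d)=\{j\in[n]:\gcd(j,n)=d\}$. $\mathcal{D}_{[n]}$ denotes the set of all positive divisors of $n$. For $\mathcal{D}\subseteq\mathcal{D}_{[n]}\setminus\{n\}$, $\mathrm{ICG}(n,\mathcal{D})$ denotes the circulant graph $\mathrm{Cay}(\mathbb{Z}_n,S)$ with connection set $S=\bigcup_{d\in\mathcal{D}}G_n(d)$ (vertex set $\mathbb{Z}_n$, $g\sim h$ iff $h-g\in S$); we write $\mathcal{D}=\mathcal{D}_S$. $\mathrm{Spec}$ denotes the multiset of eigenvalues of the adjacency matrix. *)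

theory Defs
  imports "Jordan_Normal_Form.Char_Poly"
begin

definition Gn :: "nat \<Rightarrow> nat \<Rightarrow> nat set" where
  "Gn n d = {j \<in> {1..n}. gcd j n = d}"

definition ICG_conn :: "nat \<Rightarrow> nat set \<Rightarrow> nat set" where
  "ICG_conn n D = (\<Union>d\<in>D. Gn n d)"

text \<open>Adjacency matrix of ICG(n,D) = Cay(Z_n, S); vertex k in [n] is represented by
  the index k mod n in {0..<n}; g ~ h iff (h - g) mod n is in S (as residue, n playing 0).\<close>
definition ICG_adj :: "nat \<Rightarrow> nat set \<Rightarrow> complex mat" where
  "ICG_adj n D = mat n n (\<lambda>(i, j).
      if (\<exists>s\<in>ICG_conn n D. s mod n = (j + n - i) mod n) then 1 else 0)"

definition Spec :: "complex mat \<Rightarrow> complex multiset" where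
  "Spec A = proots (char_poly A)"

end

theory Submission
  imports Defs
begin

text \<open>Let \<open>n = p\<^sup>kq\<close> with \<open>q\<close> odd, and let \<open>x\<^sub>i\<close>, \<open>y\<^sub>i\<close> be the indicators of
  \<open>p\<^sup>iq \<in> D\<close>, \<open>p\<^sup>i \<in> D\<close>. The eigenvalues are
  \<open>\<lambda>\<^sub>j = \<Sum>\<^sub>i \<Delta>y\<^sub>i p\<^bsup>k-i\<^esup>q [p\<^bsup>k-i\<^esup>q | j] + \<Sum>\<^sub>i \<Delta>(x-y)\<^sub>i p\<^bsup>k-i\<^esup> [p\<^bsup>k-i\<^esup> | j]\<close>,
  with \<open>\<Delta>\<close> the backward difference. Modulo \<open>q\<close> the first sum vanishes, so that \<open>\<lambda>\<^sub>j\<close> depends only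
  on \<open>gcd j (p\<^sup>k)\<close>. The degree \<open>\<lambda>\<^sub>0\<close> is the largest eigenvalue and thus known; the
  remaining classes of \<open>j\<close> have super-increasing sizes, so the multiset of residues modulo \<open>q\<close>
  determines the residue on every class. This yields \<open>x\<^sub>i - y\<^sub>i\<close> modulo \<open>q\<close>, hence exactly as
  \<open>q \<ge> 3\<close>. Finally \<open>\<lambda>\<^sub>0\<close> determines \<open>\<Sum>\<^sub>i \<Delta>y\<^sub>i p\<^bsup>k-i\<^esup>\<close>, and from it all \<open>y\<^sub>i\<close>, because
  \<open>y\<^sub>k\<close> is known from \<open>x\<^sub>k = 0\<close>.\<close>

section \<open>Additive characters of the integers modulo n and their sums\<close>

definition root_char :: "nat \<Rightarrow> int \<Rightarrow> complex" where
  "root_char n a = cis (2 * pi * (of_int a / of_nat n))"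

lemma root_char_0 [simp]: "root_char n 0 = 1"
  by (simp add: root_char_def)

lemma norm_root_char [simp]: "norm (root_char n a) = 1"
  by (simp add: root_char_def)

lemma root_char_add: "root_char n (a + b) = root_char n a * root_char n b"
  by (simp add: root_char_def cis_mult add_divide_distrib distrib_left)

lemma root_char_power: "root_char n a ^ t = root_char n (int t * a)"
  by (induction t) (simp_all add: root_char_add distrib_right)

lemma root_char_mult_cancel:
  assumes "m > 0"
  shows "root_char (m * n) (int m * a) = root_char n a"
  using assms by (simp add: root_char_def)

lemma root_char_eq_1_iff:
  assumes "n > 0"
  shows "root_char n a = 1 \<longleftrightarrow> int n dvd a"
proof
  assume "int n dvd a"
  then obtain b where "a = int n * b" ..
  then show "root_char n a = 1"
    using assms by (simp add: root_char_def)
next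
  assume "root_char n a = 1"
  then have "cos (2 * pi * (of_int a / of_nat n)) = 1"
    by (simp add: root_char_def complex_eq_iff)
  then obtain b :: int where "2 * pi * (of_int a / of_nat n) = of_int b * 2 * pi"
    using cos_one_2pi_int by auto
  then have "of_int a = (of_int (b * int n) :: real)"
    using assms by (simp add: field_simps)
  then have "a = b * int n"
    by (simp only: of_int_eq_iff)
  then show "int n dvd a" by simp
qed

lemma root_char_cong:
  assumes "n > 0" and "int n dvd a - b"
  shows "root_char n a = root_char n b"
  using root_char_add[of n "a - b" b] root_char_eq_1_iff[of n "a - b"] assms by simp

lemma sum_root_char:
  assumes "n > 0"
  shows "(\<Sum>t<n. root_char n (int t * a)) = (if int n dvd a then of_nat n else 0)"
proof (cases "int n dvd a")
  case True
  then have "root_char n (int t * a) = 1" for t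
    using assms by (simp add: root_char_eq_1_iff)
  then show ?thesis using True by simp
next
  case False
  then have "root_char n a \<noteq> 1" using assms by (simp add: root_char_eq_1_iff)
  then have "(\<Sum>t<n. root_char n a ^ t) = (root_char n a ^ n - 1) / (root_char n a - 1)"
    by (rule geometric_sum)
  also have "root_char n a ^ n = 1"
    using assms by (simp add: root_char_power root_char_eq_1_iff)
  finally show ?thesis using False by (simp add: root_char_power)
qed

text \<open>Writing s = m * t turns this into a full character sum modulo N. It evaluates each
  character on the indicator of a subgroup, the only sums that the eigenvalue formula
  requires.\<close>

lemma sum_root_char_multiples:
  assumes "m > 0" and "N > 0"
  shows "(\<Sum>s<m * N. of_bool (m dvd s) * root_char (m * N) (int s * int j))
    = (if N dvd j then of_nat N else 0)"
proof -
  have "(\<Sum>s<m * N. of_bool (m dvd s) * root_char (m * N) (int s * int j))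
      = (\<Sum>s | s < m * N \<and> m dvd s. root_char (m * N) (int s * int j))"
    by (intro sum.mono_neutral_cong_right) auto
  also have "\<dots> = (\<Sum>t<N. root_char N (int t * int j))"
  proof (rule sum.reindex_bij_witness[of _ "\<lambda>t. m * t" "\<lambda>s. s div m"])
    fix s assume "s \<in> {s. s < m * N \<and> m dvd s}"
    then obtain t where "s = m * t" by auto
    then show "root_char N (int (s div m) * int j) = root_char (m * N) (int s * int j)"
      using assms root_char_mult_cancel[of m N "int t * int j"] by (simp add: mult.assoc)
  qed (use assms in \<open>auto simp: less_mult_imp_div_less mult.commute\<close>)
  also have "\<dots> = (if N dvd j then of_nat N else 0)"
    using sum_root_char[OF assms(2), of "int j"] by simp
  finally show ?thesis .
qed

section \<open>Diagonalisation of circulant matrices by characters\<close>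

lemma similar_circulant_diag:
  fixes f :: "nat \<Rightarrow> complex"
  assumes "n > 0"
  shows "similar_mat (mat n n (\<lambda>(i, j). f ((j + n - i) mod n)))
    (mat n n (\<lambda>(i, l). if i = l then \<Sum>s<n. f s * root_char n (int s * int l) else 0))"
    (is "similar_mat ?A ?L")
proof (rule similar_matI)
  \<comment> \<open>\<open>?P\<close> is the Fourier matrix, whose columns are the characters, and
    \<open>?Q\<close> is its conjugate transpose divided by n; orthogonality of characters makes
    them inverse to each other.\<close>
  let ?P = "mat n n (\<lambda>(j, l). root_char n (int j * int l))"
  let ?Q = "mat n n (\<lambda>(l, j). root_char n (- (int l * int j)) / of_nat n)"
  show carr: "{?A, ?L, ?P, ?Q} \<subseteq> carrier_mat n n" by auto
  have orth: "(\<Sum>l<n. root_char n (int l * (int i - int j))) = (if i = j then of_nat n else 0)"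
    if "i < n" "j < n" for i j
  proof -
    have "int n dvd int i - int j \<longleftrightarrow> i = j"
      using that by (metis mod_eq_dvd_iff mod_less of_nat_eq_iff zmod_int)
    then show ?thesis using sum_root_char[OF assms] by simp
  qed
  show PQ: "?P * ?Q = 1\<^sub>m n"
  proof (rule eq_matI)
    fix i j assume "i < dim_row (1\<^sub>m n)" "j < dim_col (1\<^sub>m n)"
    then have ij: "i < n" "j < n" by auto
    have "(?P * ?Q) $$ (i, j)
        = (\<Sum>l<n. root_char n (int i * int l) * (root_char n (- (int l * int j)) / of_nat n))"
      using ij by (simp add: scalar_prod_def atLeast0LessThan)
    also have "\<dots> = (\<Sum>l<n. root_char n (int l * (int i - int j))) / of_nat n"
      by (simp add: sum_divide_distrib root_char_add[symmetric] algebra_simps)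
    finally show "(?P * ?Q) $$ (i, j) = 1\<^sub>m n $$ (i, j)"
      using ij assms orth by simp
  qed auto
  show "?Q * ?P = 1\<^sub>m n"
  proof (rule eq_matI)
    fix i j assume "i < dim_row (1\<^sub>m n)" "j < dim_col (1\<^sub>m n)"
    then have ij: "i < n" "j < n" by auto
    have "(?Q * ?P) $$ (i, j)
        = (\<Sum>l<n. root_char n (- (int i * int l)) / of_nat n * root_char n (int l * int j))"
      using ij by (simp add: scalar_prod_def atLeast0LessThan)
    also have "\<dots> = (\<Sum>l<n. root_char n (int l * (int j - int i))) / of_nat n"
      by (simp add: sum_divide_distrib root_char_add[symmetric] algebra_simps)
    finally show "(?Q * ?P) $$ (i, j) = 1\<^sub>m n $$ (i, j)"
      using ij assms orth by simp
  qed auto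
  \<comment> \<open>Each character is an eigenvector: after substituting s = j - i modulo n, the
    character of s + i splits, and the factor depending on i leaves the sum.\<close>
  have AP: "?A * ?P = ?P * ?L"
  proof (rule eq_matI)
    fix i l assume "i < dim_row (?P * ?L)" "l < dim_col (?P * ?L)"
    then have il: "i < n" "l < n" by auto
    have "(?A * ?P) $$ (i, l) = (\<Sum>j<n. f ((j + n - i) mod n) * root_char n (int j * int l))"
      using il by (simp add: scalar_prod_def atLeast0LessThan)
    also have "\<dots> = (\<Sum>s<n. f s * root_char n (int ((s + i) mod n) * int l))"
    proof (rule sum.reindex_bij_witness[of _ "\<lambda>s. (s + i) mod n" "\<lambda>j. (j + n - i) mod n"])
      show rev1: "((j + n - i) mod n + i) mod n = j" if "j \<in> {..<n}" for j
        using that il by (simp add: mod_add_left_eq)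
      show "((s + i) mod n + n - i) mod n = s" if "s \<in> {..<n}" for s
      proof -
        have "((s + i) mod n + n - i) mod n = ((s + i) mod n + (n - i)) mod n"
          using il by simp
        also have "\<dots> = (s + i + (n - i)) mod n" by (simp add: mod_add_left_eq)
        finally show ?thesis using that il by simp
      qed
      show "f ((j + n - i) mod n) * root_char n (int (((j + n - i) mod n + i) mod n) * int l)
          = f ((j + n - i) mod n) * root_char n (int j * int l)" if "j \<in> {..<n}" for j
        using rev1[OF that] by simp
    qed (use assms in auto)
    also have "\<dots> = (\<Sum>s<n. root_char n (int i * int l) * (f s * root_char n (int s * int l)))"
    proof (rule sum.cong)
      fix s
      have "int n dvd int ((s + i) mod n) - (int s + int i)"
        by (metis mod_eq_dvd_iff mod_mod_trivial of_nat_add zmod_int)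
      then have "int n dvd int ((s + i) mod n) * int l - (int s + int i) * int l"
        by (metis dvd_mult2 left_diff_distrib)
      then have "root_char n (int ((s + i) mod n) * int l) = root_char n ((int s + int i) * int l)"
        using assms by (rule root_char_cong[rotated])
      then show "f s * root_char n (int ((s + i) mod n) * int l)
          = root_char n (int i * int l) * (f s * root_char n (int s * int l))"
        by (simp add: distrib_right root_char_add)
    qed simp
    also have "\<dots> = (?P * ?L) $$ (i, l)"
      using il by (simp add: scalar_prod_def atLeast0LessThan sum_distrib_left if_distrib
          cong: if_cong)
    finally show "(?A * ?P) $$ (i, l) = (?P * ?L) $$ (i, l)" .
  qed auto
  have "?A = ?A * (?P * ?Q)" using PQ by (simp add: right_mult_one_mat[of _ n n])
  also have "\<dots> = ?P * ?L * ?Q"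
    by (subst assoc_mult_mat[symmetric, of _ n n _ n _ n]) (use AP in auto)
  finally show "?A = ?P * ?L * ?Q" .
qed

lemma Spec_circulant:
  fixes f :: "nat \<Rightarrow> complex"
  assumes "n > 0"
  shows "Spec (mat n n (\<lambda>(i, j). f ((j + n - i) mod n)))
    = image_mset (\<lambda>l. \<Sum>s<n. f s * root_char n (int s * int l)) (mset_set {..<n})"
proof -
  let ?mu = "\<lambda>l. \<Sum>s<n. f s * root_char n (int s * int l)"
  let ?L = "mat n n (\<lambda>(i, l). if i = l then ?mu l else 0)"
  have "char_poly (mat n n (\<lambda>(i, j). f ((j + n - i) mod n))) = char_poly ?L"
    by (rule char_poly_similar[OF similar_circulant_diag[OF assms]])
  also have "\<dots> = (\<Prod>a\<leftarrow>diag_mat ?L. [:- a, 1:])"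
    by (rule char_poly_upper_triangular[of _ n]) auto
  also have "diag_mat ?L = map ?mu [0..<n]"
    by (auto simp: diag_mat_def intro!: map_cong)
  finally have "Spec (mat n n (\<lambda>(i, j). f ((j + n - i) mod n)))
      = proots (\<Prod>l\<in>{..<n}. [:- ?mu l, 1:])"
    unfolding Spec_def
    by (simp add: prod.distinct_set_conv_list[symmetric] atLeast0LessThan comp_def)
  also have "\<dots> = (\<Sum>l\<in>{..<n}. {#?mu l#})"
    by (subst proots_prod) auto
  also have "\<dots> = image_mset ?mu (mset_set {..<n})"
    by (simp add: sum_unfold_sum_mset)
  finally show ?thesis .
qed

lemma ICG_adj_circulant:
  assumes "n > 0"
  shows "ICG_adj n D = mat n n (\<lambda>(i, j). of_bool (gcd ((j + n - i) mod n) n \<in> D))"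
proof -
  have "(\<exists>s\<in>ICG_conn n D. s mod n = r) \<longleftrightarrow> gcd r n \<in> D" if "r < n" for r
  proof
    assume "gcd r n \<in> D"
    \<comment> \<open>The residue 0 is represented by n in [n]; both have gcd n with n.\<close>
    moreover have "gcd (if r = 0 then n else r) n = gcd r n" by simp
    ultimately have "(if r = 0 then n else r) \<in> ICG_conn n D"
      using that assms by (auto simp: ICG_conn_def Gn_def)
    then show "\<exists>s\<in>ICG_conn n D. s mod n = r"
      using that by (metis mod_less mod_self)
  qed (auto simp: ICG_conn_def Gn_def)
  then show ?thesis
    using assms unfolding ICG_adj_def by (intro eq_matI) auto
qed


section \<open>Integer eigenvalues for n = p^k * q\<close>

definition back_diff :: "(nat \<Rightarrow> int) \<Rightarrow> nat \<Rightarrow> int" where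
  "back_diff u i = u i - (if i = 0 then 0 else u (i - 1))"

lemma sum_back_diff: "(\<Sum>i\<le>m. back_diff u i) = u m"
  by (induction m) (simp_all add: back_diff_def)

lemma back_diff_minus: "back_diff (\<lambda>i. u i - v i) i = back_diff u i - back_diff v i"
  by (simp add: back_diff_def)

definition ind_p :: "nat \<Rightarrow> nat set \<Rightarrow> nat \<Rightarrow> int" where
  "ind_p p D i = of_bool (p ^ i \<in> D)"

text \<open>The correction to \<open>ind_p\<close> when q divides s: if gcd s (p^k) = p^m, then
  membership of gcd s (p^k * q) in D has indicator \<open>ind_p p D m\<close>, plus
  \<open>ind_diff p q D m\<close> when q divides s.\<close>

definition ind_diff :: "nat \<Rightarrow> nat \<Rightarrow> nat set \<Rightarrow> nat \<Rightarrow> int" where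
  "ind_diff p q D i = of_bool (p ^ i * q \<in> D) - of_bool (p ^ i \<in> D)"

text \<open>The i-th terms come from the subgroups generated by p^i and by p^i * q, of orders
  p^(k-i) * q and p^(k-i). A character sum over a subgroup equals its order if that order divides j,
  and 0 otherwise.\<close>

definition icg_eig :: "nat \<Rightarrow> nat \<Rightarrow> nat \<Rightarrow> nat set \<Rightarrow> nat \<Rightarrow> int" where
  "icg_eig p q k D j =
    (\<Sum>i\<le>k. back_diff (ind_p p D) i * (of_bool (p ^ (k - i) * q dvd j) * int (p ^ (k - i) * q)))
    + (\<Sum>i\<le>k. back_diff (ind_diff p q D) i * (of_bool (p ^ (k - i) dvd j) * int (p ^ (k - i))))"

lemma gcd_prime_power_times_prime:
  fixes p q s :: nat
  assumes "prime p" and "prime q" and "p \<noteq> q"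
  shows "gcd s (p ^ k * q) = gcd s (p ^ k) * (if q dvd s then q else 1)"
proof (cases "q dvd s")
  case True
  then obtain t where t: "s = q * t" ..
  have "coprime (p ^ k) q"
    using assms by (simp add: primes_coprime)
  then have "gcd (q * t) (p ^ k) = gcd t (p ^ k)"
    by (simp add: coprime_commute gcd_mult_left_left_cancel)
  then show ?thesis
    using True by (simp add: t mult.commute[of _ q] gcd_mult_distrib_nat[symmetric])
next
  case False
  then have "coprime s q"
    using assms by (metis coprime_commute prime_imp_coprime)
  then show ?thesis
    using False by (simp add: gcd_mult_right_right_cancel)
qed

text \<open>The connection set is written as an integer combination of the subgroups
  \<open>p\<^sup>i\<int>\<close> and \<open>p\<^sup>iq\<int>\<close>, whose character sums are trivial to evaluate.\<close>

lemma of_bool_gcd_mem_expand: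
  fixes p q s :: nat
  assumes "prime p" and "prime q" and "p \<noteq> q"
  shows "of_bool (gcd s (p ^ k * q) \<in> D) =
    (\<Sum>i\<le>k. back_diff (ind_p p D) i * of_bool (p ^ i dvd s))
    + (\<Sum>i\<le>k. back_diff (ind_diff p q D) i * of_bool (p ^ i * q dvd s))"
proof -
  \<comment> \<open>Here m is the p-adic valuation of s capped at k, so p^i divides s exactly for i
    up to m, and sums of backward differences telescope to the value at m.\<close>
  obtain m where m: "m \<le> k" "gcd s (p ^ k) = p ^ m"
    using divides_primepow_nat[OF assms(1)] by (metis gcd_dvd2)
  have p1: "p > 1" using assms(1) prime_gt_1_nat by blast
  have pdvd: "p ^ i dvd s \<longleftrightarrow> i \<le> m" if "i \<le> k" for i
  proof -
    have "p ^ i dvd s \<longleftrightarrow> p ^ i dvd gcd s (p ^ k)"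
      using that by (simp add: le_imp_power_dvd)
    then show ?thesis
      using m p1 by (simp add: dvd_power_iff_le)
  qed
  have pqdvd: "p ^ i * q dvd s \<longleftrightarrow> p ^ i dvd s \<and> q dvd s" for i
    using assms by (metis divides_mult dvd_mult_left dvd_mult_right coprime_power_left_iff
        primes_coprime)
  have tele: "(\<Sum>i\<le>k. back_diff u i * of_bool (i \<le> m)) = u m" for u
  proof -
    have "(\<Sum>i\<le>k. back_diff u i * of_bool (i \<le> m)) = (\<Sum>i\<le>m. back_diff u i)"
      using m(1) by (intro sum.mono_neutral_cong_right) auto
    then show ?thesis by (simp add: sum_back_diff)
  qed
  have tele_dvd: "(\<Sum>i\<le>k. back_diff u i * of_bool (p ^ i dvd s)) = u m" for u
    unfolding tele[of u, symmetric] by (intro sum.cong) (simp_all add: pdvd)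
  have "(\<Sum>i\<le>k. back_diff (ind_diff p q D) i * of_bool (p ^ i * q dvd s))
      = (if q dvd s then ind_diff p q D m else 0)"
    by (cases "q dvd s") (simp_all only: pqdvd tele_dvd simp_thms of_bool_eq if_True if_False
        mult_zero_right sum.neutral_const)
  then show ?thesis
    unfolding tele_dvd
    by (simp only: gcd_prime_power_times_prime[OF assms] m) (simp add: ind_p_def ind_diff_def)
qed

lemma icg_eig_eq_character_sum:
  fixes p q :: nat
  assumes "prime p" and "prime q" and "p \<noteq> q" and n: "n = p ^ k * q"
  shows "(\<Sum>s<n. of_bool (gcd s n \<in> D) * root_char n (int s * int j)) = of_int (icg_eig p q k D j)"
proof -
  let ?c = "\<lambda>s. root_char n (int s * int j)"
  let ?a = "back_diff (ind_p p D)" and ?b = "back_diff (ind_diff p q D)"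
  have pos: "p > 0" "q > 0" using assms by (auto simp: prime_gt_0_nat)
  have n1: "n = p ^ i * (p ^ (k - i) * q)" "n = p ^ i * q * p ^ (k - i)" if "i \<le> k" for i
    using that by (simp_all add: n mult_ac power_add[symmetric])
  have S1: "(\<Sum>s<n. of_bool (p ^ i dvd s) * ?c s)
      = of_bool (p ^ (k - i) * q dvd j) * of_nat (p ^ (k - i) * q)" if "i \<le> k" for i
    using sum_root_char_multiples[of "p ^ i" "p ^ (k - i) * q" j] pos n1(1)[OF that] by simp
  have S2: "(\<Sum>s<n. of_bool (p ^ i * q dvd s) * ?c s)
      = of_bool (p ^ (k - i) dvd j) * of_nat (p ^ (k - i))" if "i \<le> k" for i
    using sum_root_char_multiples[of "p ^ i * q" "p ^ (k - i)" j] pos n1(2)[OF that] by simp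
  have "(of_bool (gcd s n \<in> D) :: complex) =
      (\<Sum>i\<le>k. of_int (?a i) * of_bool (p ^ i dvd s))
      + (\<Sum>i\<le>k. of_int (?b i) * of_bool (p ^ i * q dvd s))" for s
    using arg_cong[OF of_bool_gcd_mem_expand[OF assms(1-3), of s k D], of "of_int :: int \<Rightarrow> complex"]
    by (simp add: n)
  then have "(\<Sum>s<n. of_bool (gcd s n \<in> D) * ?c s) =
      (\<Sum>s<n. \<Sum>i\<le>k. of_int (?a i) * (of_bool (p ^ i dvd s) * ?c s))
      + (\<Sum>s<n. \<Sum>i\<le>k. of_int (?b i) * (of_bool (p ^ i * q dvd s) * ?c s))"
    by (simp only: distrib_right sum_distrib_right sum.distrib mult.assoc)
  also have "\<dots> = (\<Sum>i\<le>k. of_int (?a i) * (\<Sum>s<n. of_bool (p ^ i dvd s) * ?c s))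
      + (\<Sum>i\<le>k. of_int (?b i) * (\<Sum>s<n. of_bool (p ^ i * q dvd s) * ?c s))"
    by (simp only: sum_distrib_left sum.swap[of _ "{..<n}"])
  also have "\<dots> = of_int (icg_eig p q k D j)"
    unfolding icg_eig_def of_int_add of_int_sum of_int_mult
    by (intro arg_cong2[where f = "(+)"] sum.cong refl)
      (simp_all only: atMost_iff S1 S2 of_int_of_nat_eq of_int_of_bool)
  finally show ?thesis .
qed

lemma Spec_ICG_adj:
  fixes p q :: nat
  assumes "prime p" and "prime q" and "p \<noteq> q" and n: "n = p ^ k * q"
  shows "Spec (ICG_adj n D) = image_mset (\<lambda>j. of_int (icg_eig p q k D j)) (mset_set {..<n})"
proof -
  have "n > 0" using assms by (simp add: prime_gt_0_nat)
  then show ?thesis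
    using Spec_circulant[of n "\<lambda>s. of_bool (gcd s n \<in> D)"]
    by (simp add: ICG_adj_circulant icg_eig_eq_character_sum[OF assms])
qed

text \<open>Triangle inequality: the eigenvalue is a sum of unimodular numbers with coefficients 0
  or 1, and at j = 0 all these numbers are 1. This lets the spectrum reveal the degree.\<close>

lemma abs_icg_eig_le:
  fixes p q :: nat
  assumes "prime p" and "prime q" and "p \<noteq> q"
  shows "\<bar>icg_eig p q k D j\<bar> \<le> icg_eig p q k D 0"
proof -
  define n where "n = p ^ k * q"
  note eig = icg_eig_eq_character_sum[OF assms n_def, of D]
  have "of_int (icg_eig p q k D 0) = (of_real (\<Sum>s<n. of_bool (gcd s n \<in> D)) :: complex)"
    using eig[of 0] by simp
  then have "of_int (icg_eig p q k D 0) = (\<Sum>s<n. of_bool (gcd s n \<in> D) :: real)"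
    by (metis of_real_eq_iff of_real_of_int_eq)
  moreover have "norm (of_int (icg_eig p q k D j) :: complex) \<le> (\<Sum>s<n. of_bool (gcd s n \<in> D))"
    unfolding eig[symmetric] by (rule sum_norm_le) (simp add: norm_mult)
  ultimately have "real_of_int \<bar>icg_eig p q k D j\<bar> \<le> of_int (icg_eig p q k D 0)"
    by simp
  then show ?thesis by linarith
qed

section \<open>Counting and divisibility arguments for recovering the divisor set\<close>

lemma card_eq_if_image_mset_eq:
  assumes "image_mset f (mset_set A) = image_mset g (mset_set A)" and "finite A"
  shows "card {j \<in> A. f j = v} = card {j \<in> A. g j = v}"
proof -
  have "size (filter_mset (\<lambda>x. x = v) (image_mset f (mset_set A)))
      = size (filter_mset (\<lambda>x. x = v) (image_mset g (mset_set A)))"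
    using assms by simp
  then show ?thesis
    using assms(2) by (simp add: filter_mset_image_mset filter_mset_mset_set)
qed

lemma card_multiples_lessThan:
  fixes m N :: nat
  assumes "m > 0"
  shows "card {j. j < m * N \<and> m dvd j} = N"
proof -
  have "bij_betw (\<lambda>t. m * t) {..<N} {j. j < m * N \<and> m dvd j}"
    using assms by (intro bij_betwI[where g = "\<lambda>j. j div m"]) auto
  then show ?thesis using bij_betw_same_card by fastforce
qed

text \<open>At the lowest \<open>p\<close>-adic level \<open>i < k\<close> where \<open>g1\<close> and \<open>g2\<close> differ, the value \<open>g1 (p ^ i)\<close> is
  taken by \<open>g1\<close> on all of level \<open>i\<close>, which is larger than all levels strictly between \<open>i\<close> and \<open>k\<close>
  together, hence too large to be compensated by \<open>g2\<close>. Level \<open>k\<close> has to be excluded by the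
  hypothesis \<open>g1 0 = g2 0\<close>, since for \<open>p = 2\<close> it tips the balance.\<close>

lemma level_values_determined:
  fixes p n k :: nat and g1 g2 :: "nat \<Rightarrow> 'a"
  assumes "prime p" and "n > 0" and "p ^ k dvd n"
    and g1: "\<And>j. g1 j = g1 (gcd j (p ^ k))" and g2: "\<And>j. g2 j = g2 (gcd j (p ^ k))"
    and mset: "image_mset g1 (mset_set {..<n}) = image_mset g2 (mset_set {..<n})"
    and zero: "g1 0 = g2 0"
    and "i \<le> k"
  shows "g1 (p ^ i) = g2 (p ^ i)"
  using \<open>i \<le> k\<close>
proof (induction i rule: less_induct)
  case (less i)
  have p1: "p > 1" using assms(1) prime_gt_1_nat by blast
  have top: "g1 j = g2 j" if "p ^ k dvd j" for j
  proof -
    have "gcd j (p ^ k) = gcd 0 (p ^ k)" using that by (simp add: gcd_proj2_iff)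
    then show ?thesis using g1[of j] g2[of j] g1[of 0] g2[of 0] zero by simp
  qed
  show ?case
  proof (cases "i = k")
    case True
    then show ?thesis using top by simp
  next
    case False
    then have ik: "i < k" using less.prems by simp
    show ?thesis
    proof (rule ccontr)
      assume neq: "g1 (p ^ i) \<noteq> g2 (p ^ i)"
      define v where "v = g1 (p ^ i)"
      define C1 where "C1 = {j \<in> {..<n}. g1 j = v}"
      define C2 where "C2 = {j \<in> {..<n}. g2 j = v}"
      define M where "M = (\<lambda>l. {j. j < n \<and> p ^ l dvd j})"
      have fin: "finite C1" "finite C2" "\<And>l. finite (M l)"
        by (auto simp: C1_def C2_def M_def)
      have anti: "M l' \<subseteq> M l" if "l \<le> l'" for l l'
        using that by (auto simp: M_def dest: power_le_dvd)
      have low: "g1 j = g2 j" if "\<not> p ^ i dvd j" for j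
      proof -
        obtain m where m: "m \<le> k" "gcd j (p ^ k) = p ^ m"
          using divides_primepow_nat[OF assms(1)] by (metis gcd_dvd2)
        have "m < i"
          using that m(2) by (metis dvd_trans gcd_dvd1 le_imp_power_dvd linorder_not_le)
        then show ?thesis using less.IH[of m] m g1[of j] g2[of j] by simp
      qed
      have level: "gcd j (p ^ k) = p ^ i" if "p ^ i dvd j" "\<not> p ^ Suc i dvd j" for j
      proof -
        obtain m where m: "m \<le> k" "gcd j (p ^ k) = p ^ m"
          using divides_primepow_nat[OF assms(1)] by (metis gcd_dvd2)
        have "p ^ i dvd p ^ m"
          using that(1) ik m(2) by (metis gcd_greatest le_imp_power_dvd less_imp_le)
        then have "i \<le> m" using p1 by (simp add: dvd_power_iff_le)
        moreover have "\<not> Suc i \<le> m"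
          using that(2) m(2) by (metis dvd_trans gcd_dvd1 le_imp_power_dvd)
        ultimately show ?thesis using m(2) by (simp add: le_antisym not_less_eq_eq)
      qed
      have sub1: "M i - M (Suc i) \<subseteq> C1 \<inter> (M i - M k)"
      proof
        fix j assume j: "j \<in> M i - M (Suc i)"
        then have "g1 j = v"
          using level[of j] g1[of j] by (auto simp: M_def v_def)
        then show "j \<in> C1 \<inter> (M i - M k)"
          using j anti[of "Suc i" k] ik by (auto simp: M_def C1_def)
      qed
      have sub2: "C2 \<inter> (M i - M k) \<subseteq> M (Suc i) - M k"
      proof
        fix j assume j: "j \<in> C2 \<inter> (M i - M k)"
        then have "p ^ i dvd j" "g2 j = v" by (auto simp: M_def C2_def)
        then have "p ^ Suc i dvd j"
          using level[of j] g2[of j] neq unfolding v_def by metis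
        then show "j \<in> M (Suc i) - M k" using j by (auto simp: M_def)
      qed
      \<comment> \<open>Below level i agreement is the induction hypothesis, at level k it is
        \<open>top\<close>. So the fibres of v, equal in size, must also have equally many elements
        in the levels from i to k - 1.\<close>
      have rest: "C1 - (M i - M k) = C2 - (M i - M k)"
        using low top by (auto simp: C1_def C2_def M_def)
      have "card C1 = card C2"
        unfolding C1_def C2_def by (rule card_eq_if_image_mset_eq[OF mset]) simp
      then have "card (C1 \<inter> (M i - M k)) = card (C2 \<inter> (M i - M k))"
        using rest fin by (metis add_right_cancel card_Int_Diff)
      moreover have "card (M i - M (Suc i)) \<le> card (C1 \<inter> (M i - M k))"
        using sub1 fin by (intro card_mono) auto
      moreover have "card (C2 \<inter> (M i - M k)) \<le> card (M (Suc i) - M k)"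
        using sub2 fin by (intro card_mono) auto
      moreover have "card (M i - M (Suc i)) = card (M i) - card (M (Suc i))"
        using anti fin by (simp add: card_Diff_subset)
      moreover have "card (M (Suc i) - M k) = card (M (Suc i)) - card (M k)"
        using anti fin ik by (simp add: card_Diff_subset)
      \<comment> \<open>Hence level i has at least card (M (Suc i)) elements, strictly more than M
        (Suc i) - M k, since M k contains 0.\<close>
      moreover have "card (M i) \<ge> 2 * card (M (Suc i))"
      proof -
        obtain N where N: "n = p ^ Suc i * N"
          using assms(3) ik by (metis Suc_leI dvdE power_le_dvd)
        have "card (M (Suc i)) = N"
          unfolding M_def N using p1 by (intro card_multiples_lessThan) simp
        moreover have "card (M i) = p * N"
        proof -
          have "n = p ^ i * (p * N)" by (simp add: N)
          then show ?thesis
            unfolding M_def using p1 card_multiples_lessThan[of "p ^ i" "p * N"] by simp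
        qed
        ultimately show ?thesis using p1 by simp
      qed
      moreover have "card (M k) > 0"
        using fin assms(2) by (subst card_gt_0_iff) (auto simp: M_def intro: exI[of _ 0])
      moreover have "card (M k) \<le> card (M (Suc i))"
        using anti fin ik by (intro card_mono) auto
      ultimately show False by linarith
    qed
  qed
qed

text \<open>Consecutive tails differ in one term, whose weight is a power of p and so invertible
  modulo q. Thus q divides every backward difference, hence their partial sum e i, which is too
  small to be a nonzero multiple.\<close>

lemma eq_0_if_tail_sums_dvd:
  fixes p q k :: nat and e :: "nat \<Rightarrow> int"
  assumes "coprime p q"
    and tails: "\<And>m. m \<le> k \<Longrightarrow> int q dvd (\<Sum>i=m..k. back_diff e i * int (p ^ (k - i)))"
    and small: "\<And>i. \<bar>e i\<bar> < int q" and "i \<le> k"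
  shows "e i = 0"
proof -
  have "int q dvd back_diff e l" if "l \<le> k" for l
  proof -
    have "(\<Sum>i=l..k. back_diff e i * int (p ^ (k - i)))
        = back_diff e l * int (p ^ (k - l)) + (\<Sum>i=Suc l..k. back_diff e i * int (p ^ (k - i)))"
      using that by (simp add: sum.atLeast_Suc_atMost)
    moreover have "int q dvd (\<Sum>i=Suc l..k. back_diff e i * int (p ^ (k - i)))"
      using tails[of "Suc l"] by (cases "Suc l \<le> k") auto
    ultimately have "int q dvd back_diff e l * int (p ^ (k - l))"
      using tails[OF that] by (simp only: dvd_add_left_iff)
    moreover have "coprime (int q) (int (p ^ (k - l)))"
      using assms(1) by (simp add: coprime_commute[of q])
    ultimately show ?thesis by (simp add: coprime_dvd_mult_left_iff)
  qed
  then have "int q dvd (\<Sum>l\<le>i. back_diff e l)"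
    using \<open>i \<le> k\<close> by (intro dvd_sum) auto
  then show ?thesis
    using small[of i] dvd_imp_le_int[of "e i" "int q"] by (force simp: sum_back_diff)
qed

text \<open>Passing from k + 1 to k, the unweighted last term d (k+1) - d k cancels the right-hand
  side, leaving p times the shorter sum equal to d k. So p divides d k, which forces d k = 0, and
  the hypothesis recurs for k; the right-hand side d k is chosen for this descent.\<close>

lemma eq_0_if_weighted_back_diff_sum:
  fixes p k :: nat and d :: "nat \<Rightarrow> int"
  assumes "p \<ge> 2" and "\<And>i. \<bar>d i\<bar> \<le> 1"
    and "(\<Sum>i\<le>k. back_diff d i * int (p ^ (k - i))) = d k" and "i < k"
  shows "d i = 0"
  using assms(3,4)
proof (induction k)
  case (Suc k)
  have "(\<Sum>i\<le>k. back_diff d i * int (p ^ (Suc k - i)))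
      = int p * (\<Sum>i\<le>k. back_diff d i * int (p ^ (k - i)))"
    unfolding sum_distrib_left by (intro sum.cong) (simp_all add: Suc_diff_le)
  then have eq: "int p * (\<Sum>i\<le>k. back_diff d i * int (p ^ (k - i))) = d k"
    using Suc.prems(1) by (simp add: back_diff_def)
  then have "int p dvd d k" by (metis dvd_triv_left)
  moreover have "\<bar>d k\<bar> < int p" using assms(1) assms(2)[of k] by linarith
  ultimately have dk: "d k = 0"
    using dvd_imp_le_int[of "d k" "int p"] by force
  then have "(\<Sum>i\<le>k. back_diff d i * int (p ^ (k - i))) = d k"
    using eq assms(1) by simp
  then show ?case
    using Suc.IH Suc.prems(2) dk by (cases "i = k") auto
qed simp

section \<open>From equal spectra to equal divisor sets\<close>

theorem Spec_ICG_adj_prime_power_times_prime_inj: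
  fixes p q n k :: nat
  assumes "prime p" and "prime q" and "p \<noteq> q" and "q \<noteq> 2" and n: "n = p ^ k * q"
    and D1: "D1 \<subseteq> {d. d dvd n} - {n}" and D2: "D2 \<subseteq> {d. d dvd n} - {n}"
    and spec: "Spec (ICG_adj n D1) = Spec (ICG_adj n D2)"
  shows "D1 = D2"
proof -
  let ?E1 = "icg_eig p q k D1" and ?E2 = "icg_eig p q k D2"
  have p2: "p \<ge> 2" and q3: "q \<ge> 3"
    using assms(1,2,4) prime_ge_2_nat[of p] prime_ge_2_nat[of q] by auto
  have n0: "n > 0" using n p2 q3 by simp
  have cop: "coprime p q" using assms by (simp add: primes_coprime)
  have eigs: "image_mset ?E1 (mset_set {..<n}) = image_mset ?E2 (mset_set {..<n})"
  proof -
    have "image_mset (of_int :: int \<Rightarrow> complex) (image_mset ?E1 (mset_set {..<n}))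
        = image_mset of_int (image_mset ?E2 (mset_set {..<n}))"
      using spec by (simp add: Spec_ICG_adj[OF assms(1-3) n] multiset.map_comp comp_def)
    then show ?thesis
      using multiset.inj_map[of "of_int :: int \<Rightarrow> complex"] by (simp add: inj_on_def)
  qed
  have deg: "?E1 0 = ?E2 0"
  proof (rule antisym)
    \<comment> \<open>Each degree occurs among the eigenvalues of the other graph and is therefore
      bounded by the other degree.\<close>
    have range: "?E1 ` {..<n} = ?E2 ` {..<n}"
      using arg_cong[OF eigs, of set_mset] by simp
    have "?E1 0 \<in> ?E2 ` {..<n}" using range n0 by blast
    then show "?E1 0 \<le> ?E2 0"
      using abs_icg_eig_le[OF assms(1-3), of k D2] by (auto intro: order_trans[OF abs_ge_self])
    have "?E2 0 \<in> ?E1 ` {..<n}" using range n0 by blast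
    then show "?E2 0 \<le> ?E1 0"
      using abs_icg_eig_le[OF assms(1-3), of k D1] by (auto intro: order_trans[OF abs_ge_self])
  qed
  \<comment> \<open>The second sum of \<open>icg_eig\<close>; every term of the first carries a
    factor q.\<close>
  define w where "w = (\<lambda>D j. \<Sum>i\<le>k. back_diff (ind_diff p q D) i
      * (of_bool (p ^ (k - i) dvd j) * int (p ^ (k - i))))"
  have w_cong: "icg_eig p q k D j mod int q = w D j mod int q" for D j
  proof -
    have "int q dvd icg_eig p q k D j - w D j"
      unfolding icg_eig_def w_def by (simp add: dvd_sum)
    then show ?thesis by (simp add: mod_eq_dvd_iff)
  qed
  have w_gcd: "w D j = w D (gcd j (p ^ k))" for D j
    unfolding w_def by (intro sum.cong) (simp_all add: le_imp_power_dvd)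
  have w_eq: "w D1 (p ^ i) mod int q = w D2 (p ^ i) mod int q" if "i \<le> k" for i
  proof (rule level_values_determined[where n = n and k = k and ?g1.0 = "\<lambda>j. w D1 j mod int q"
        and ?g2.0 = "\<lambda>j. w D2 j mod int q"])
    have "image_mset (\<lambda>x. x mod int q) (image_mset ?E1 (mset_set {..<n}))
        = image_mset (\<lambda>x. x mod int q) (image_mset ?E2 (mset_set {..<n}))"
      using eigs by simp
    then show "image_mset (\<lambda>j. w D1 j mod int q) (mset_set {..<n})
        = image_mset (\<lambda>j. w D2 j mod int q) (mset_set {..<n})"
      by (simp add: multiset.map_comp comp_def w_cong)
    show "w D1 0 mod int q = w D2 0 mod int q"
      using deg w_cong[of D1 0] w_cong[of D2 0] by simp
  qed (use assms(1) n n0 that w_gcd in \<open>auto simp del: gcd_0_nat intro: arg_cong2[where f = "(mod)"]\<close>)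
  have diff_eq: "ind_diff p q D1 i = ind_diff p q D2 i" if "i \<le> k" for i
  proof -
    have "ind_diff p q D1 i - ind_diff p q D2 i = 0"
    proof (rule eq_0_if_tail_sums_dvd[OF cop _ _ that])
      fix m assume m: "m \<le> k"
      \<comment> \<open>At j = p^(k-m) the surviving terms are those with k - i at most k - m, that
        is, i from m on.\<close>
      have w_tail: "w D (p ^ (k - m)) = (\<Sum>i=m..k. back_diff (ind_diff p q D) i * int (p ^ (k - i)))"
        for D
        unfolding w_def using m p2
        by (intro sum.mono_neutral_cong_right) (auto simp: dvd_power_iff_le)
      have "int q dvd w D1 (p ^ (k - m)) - w D2 (p ^ (k - m))"
        using w_eq[of "k - m"] by (simp add: mod_eq_dvd_iff)
      then show "int q dvd (\<Sum>i=m..k.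
          back_diff (\<lambda>i. ind_diff p q D1 i - ind_diff p q D2 i) i * int (p ^ (k - i)))"
        by (simp add: w_tail back_diff_minus left_diff_distrib sum_subtractf)
    next
      \<comment> \<open>Both values lie in {-1, 0, 1}, so they differ by at most 2; this is where q
        must be at least 3.\<close>
      fix i show "\<bar>ind_diff p q D1 i - ind_diff p q D2 i\<bar> < int q"
        using q3 by (simp add: ind_diff_def of_bool_def)
    qed
    then show ?thesis by simp
  qed
  have p_eq: "ind_p p D1 i = ind_p p D2 i" if "i \<le> k" for i
  proof -
    let ?d = "\<lambda>i. ind_p p D1 i - ind_p p D2 i"
    have "p ^ k * q \<notin> D1" "p ^ k * q \<notin> D2" using D1 D2 n by auto
    then have dk: "?d k = 0"
      using diff_eq[of k] by (simp add: ind_diff_def ind_p_def)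
    \<comment> \<open>The \<open>ind_diff\<close> parts of the two degrees coincide and cancel,
      leaving an identity for \<open>ind_p\<close> alone from which the factor q can be
      removed.\<close>
    have "back_diff (ind_diff p q D1) i = back_diff (ind_diff p q D2) i" if "i \<le> k" for i
      using diff_eq that by (simp add: back_diff_def)
    then have "(\<Sum>i\<le>k. back_diff (ind_p p D1) i * int (p ^ (k - i) * q))
        = (\<Sum>i\<le>k. back_diff (ind_p p D2) i * int (p ^ (k - i) * q))"
      using deg by (simp add: icg_eig_def)
    then have "(\<Sum>i\<le>k. back_diff (ind_p p D1) i * int (p ^ (k - i))) * int q
        = (\<Sum>i\<le>k. back_diff (ind_p p D2) i * int (p ^ (k - i))) * int q"
      by (simp add: sum_distrib_right mult.assoc)
    then have "(\<Sum>i\<le>k. back_diff ?d i * int (p ^ (k - i))) = ?d k"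
      using q3 dk by (simp add: back_diff_minus left_diff_distrib sum_subtractf)
    then have "?d i = 0" if "i < k" for i
      using that p2 by (intro eq_0_if_weighted_back_diff_sum[of p ?d k]) (auto simp: ind_p_def)
    then show ?thesis using dk that by (cases "i = k") auto
  qed
  have mem_eq: "d \<in> D1 \<longleftrightarrow> d \<in> D2" if "d dvd n" for d
  proof -
    have "d = gcd d (p ^ k * q)" using that n by (simp add: gcd_proj1_iff)
    also have "\<dots> = gcd d (p ^ k) * (if q dvd d then q else 1)"
      by (rule gcd_prime_power_times_prime[OF assms(1-3)])
    finally have d: "d = gcd d (p ^ k) * (if q dvd d then q else 1)" .
    obtain i where i: "i \<le> k" "gcd d (p ^ k) = p ^ i"
      using divides_primepow_nat[OF assms(1)] by (metis gcd_dvd2)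
    have "d = p ^ i \<or> d = p ^ i * q"
      using d unfolding i(2) by (simp split: if_splits)
    then show ?thesis
      using p_eq[OF i(1)] diff_eq[OF i(1)]
      by (auto simp: ind_p_def ind_diff_def of_bool_def split: if_splits)
  qed
  then show ?thesis using D1 D2 by blast
qed

theorem theorem1p4:
  fixes p q n :: nat and D1 D2 :: "nat set"
  assumes "prime p" and "prime q" and "2 \<le> p" and "p < q"
    and "n = p ^ 3 * q"
    and "D1 \<subseteq> {d. d dvd n} - {n}"
    and "D2 \<subseteq> {d. d dvd n} - {n}"
    and "Spec (ICG_adj n D1) = Spec (ICG_adj n D2)"
  shows "D1 = D2"
  using assms by (intro Spec_ICG_adj_prime_power_times_prime_inj[of p q n 3 D1 D2]) auto

end
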